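(* Let $\Phi\in\mathbb{R}^{n\times m}$, $y\in\mathbb{R}^n$, $\lambda_0\ge0$, and let a nonempty subset $\Omega\subseteq\{1,\dots,m\}$ of coefficient indices be given. Suppose that the coefficient vector $x\in\mathbb{R}^m$ is the minimizer of the function $\|y-\Phi x\|_2^2$ subject to $\mathrm{supp}(x)\subset\Omega$, and let $\varepsilon=y-\Phi x$. Suppose it is known a priori that the size of the type-0 optimal subset (with respect to $\lambda_0$) is no larger than the integer $M$. For an integer $k\ge1$ and constant $M$ define $$q'(k,M)=\sup_{1\le j\le M}\ \frac{c(\Phi^T\varepsilon,1)+\sqrt{c^2(\Phi^T\varepsilon,k)+\lambda_0\cdot\frac{k^2(k-j)}{(k+j)^2}\cdot\sigma_{\min,k}^2\cdot\lambda^2(k;j)}}{\frac{k}{k+j}\,\sigma_{\min,k}^2\cdot\lambda^2(k;j)},$$ where $j$ ranges over integers. If $\min_{i\in\Omega}|x_i|>q'(|\Omega|,M)$, then the set $\Omega$ is at least a subset of the type-0 optimal subset.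
   Context: Setting: $n>m$; $\Phi\in\mathbb{R}^{n\times m}$ is the model matrix with columns $\phi_1,\dots,\phi_m$ and $y\in\mathbb{R}^n$ the response. $\|x\|_0$ is the number of nonzero entries of $x$, $\mathrm{supp}(x)$ the set of indices of its nonzero entries, and $|\Omega|$ the cardinality of $\Omega$. Inclusions $\subset$ allow equality. Problem (P0): $\min_{x\in\mathbb{R}^m}\|y-\Phi x\|_2^2+\lambda_0\|x\|_0$. A subset of $\{1,\dots,m\}$ that is the support of a minimizer of (P0) is called a type-0 optimal subset with respect to $\lambda_0$. For an integer $k\ge1$, $\sigma_{\min,k}^2=\inf \|\Phi\delta\|_2^2/\|\delta\|_2^2$ subject to $\|\delta\|_0\le k$, the infimum being over nonzero $\delta\in\mathbb{R}^m$. For a vector $v$ and an integer $k\ge1$, $c(v,k)=\sqrt{\sum_{i=1}^k v_{(i)}^2}$, where $|v_{(1)}|\ge|v_{(2)}|\ge\cdots$ are the entries of $v$ ordered by nonincreasing magnitude. For an integer $k\ge1$ and an integer constant $j$, $$\lambda(k;j)=1-\frac{j}{\sqrt{k}}\ \sup_{|\mathcal{I}|\le k}\ \sup_{\ell\notin\mathcal{I}}\ \|\Phi_{\mathcal{I}}^+\phi_\ell\|_2,$$ where $\mathcal{I}\subseteq\{1,\dots,m\}$ is a subset of indices, $\Phi_{\mathcal{I}}$ is the submatrix of $\Phi$ formed by the columns with indices in $\mathcal{I}$, $\ell$ ranges over column indices not in $\mathcal{I}$, and $\Phi_{\mathcal{I}}^+=(\Phi_{\mathcal{I}}^*\Phi_{\mathcal{I}})^{-1}\Phi_{\mathcal{I}}^*$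 is the Moore–Penrose pseudo-inverse, with $(\cdot)^*$ denoting the adjoint. The quantities entering $q'(k,M)$ are understood to be well defined (nonzero denominators); values of $j$ for which the expression under the square root is negative are disregarded in the supremum.
   Formalization: The formal theorem also assumes that the type-0 optimal subset S is nonempty and that λ(|Ω|;|S|) ≥ 0; the claim as stated fails without either (e.g. Φ=y=e1, λ0=2, Ω={1}, M=1 gives S empty; φ1=e1, φ2=y=10e1+e2, λ0=1/2, Ω={1}, M=1 gives S={2}). *)

theory Defs
  imports "HOL-Analysis.Analysis" "HOL-Library.Multiset"
begin

text \<open>
  Vectors in $R^n$ and $n \times m$ matrices are \<open>real ^ 'n\<close> and \<open>real ^ 'm ^ 'n\<close>,
  with \<open>n = CARD('n)\<close> and \<open>m = CARD('m)\<close>; column indices are elements of \<open>'m\<close>.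
\<close>

definition supp :: "real ^ 'm \<Rightarrow> 'm set" where
  "supp x = {i. x $ i \<noteq> 0}"

definition l0norm :: "real ^ 'm \<Rightarrow> nat" where
  "l0norm x = card (supp x)"

definition P0_objective :: "real ^ 'm ^ 'n \<Rightarrow> real ^ 'n \<Rightarrow> real \<Rightarrow> real ^ 'm \<Rightarrow> real" where
  "P0_objective \<Phi> y lam0 x = (norm (y - \<Phi> *v x))\<^sup>2 + lam0 * real (l0norm x)"

definition type0_optimal :: "real ^ 'm ^ 'n \<Rightarrow> real ^ 'n \<Rightarrow> real \<Rightarrow> 'm set \<Rightarrow> bool" where
  "type0_optimal \<Phi> y lam0 S \<longleftrightarrow>
     (\<exists>x. is_arg_min (P0_objective \<Phi> y lam0) (\<lambda>_. True) x \<and> supp x = S)"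

definition sigma_min_sq :: "real ^ 'm ^ 'n \<Rightarrow> nat \<Rightarrow> real" where
  "sigma_min_sq \<Phi> k =
     Inf {(norm (\<Phi> *v d))\<^sup>2 / (norm d)\<^sup>2 | d. d \<noteq> 0 \<and> l0norm d \<le> k}"

definition magnitudes :: "real ^ 'm \<Rightarrow> real list" where
  "magnitudes v = rev (sorted_list_of_multiset (image_mset (\<lambda>i. \<bar>v $ i\<bar>) (mset_set UNIV)))"

definition c_top :: "real ^ 'm \<Rightarrow> nat \<Rightarrow> real" where
  "c_top v k = sqrt (\<Sum>a\<leftarrow>take k (magnitudes v). a\<^sup>2)"

definition restrict_columns :: "real ^ 'm ^ 'n \<Rightarrow> 'm set \<Rightarrow> real ^ 'm ^ 'n" where
  "restrict_columns \<Phi> I = (\<chi> r i. if i \<in> I then \<Phi> $ r $ i else 0)"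

definition diag_indicator :: "'m set \<Rightarrow> real ^ 'm ^ 'm" where
  "diag_indicator I = (\<chi> i j. if i = j \<and> i \<in> I then 1 else 0)"

text \<open>
  The submatrix formed by the columns in \<open>I\<close> is zero-padded to the full index type. Its Gram
  matrix is then completed by the identity block on the complement of \<open>I\<close>, so that inverting the
  completed matrix inverts the \<open>I \<times> I\<close> Gram block. Hence \<open>pinv_columns \<Phi> I\<close> is
  $(\Phi_I^* \Phi_I)^{-1} \Phi_I^*$ with zero rows added outside \<open>I\<close>; the zero rows do not
  affect norms. As in that formula, the columns in \<open>I\<close> have to be linearly independent.
\<close>

definition pinv_columns :: "real ^ 'm ^ 'n \<Rightarrow> 'm set \<Rightarrow> real ^ 'n ^ 'm" where
  "pinv_columns \<Phi> I =
     matrix_inv (transpose (restrict_columns \<Phi> I) ** restrict_columns \<Phi> I + diag_indicator (- I))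
       ** transpose (restrict_columns \<Phi> I)"

lemma pinv_columns_correct:
  fixes \<Phi> :: "real ^ 'm ^ 'n"
  assumes inj: "\<And>u. supp u \<subseteq> I \<Longrightarrow> \<Phi> *v u = 0 \<Longrightarrow> u = 0"
  shows "diag_indicator (- I) ** pinv_columns \<Phi> I = 0"
    and "(transpose (restrict_columns \<Phi> I) ** restrict_columns \<Phi> I) ** pinv_columns \<Phi> I
           = transpose (restrict_columns \<Phi> I)"
proof -
  let ?A = "restrict_columns \<Phi> I" and ?D = "diag_indicator (- I) :: real ^ 'm ^ 'm"
  let ?G = "transpose ?A ** ?A + ?D"
  have Dv: "(?D *v v) $ i = (if i \<in> I then 0 else v $ i)" for v i
  proof -
    have "(?D *v v) $ i = (\<Sum>k\<in>UNIV. if i = k then (if i \<in> I then 0 else v $ k) else 0)"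
      unfolding matrix_vector_mult_def diag_indicator_def vec_lambda_beta
      by (rule sum.cong) auto
    thus ?thesis by simp
  qed
  have DD: "?D ** ?D = ?D"
    by (rule matrix_eq[THEN iffD2])
       (simp add: vec_eq_iff Dv flip: matrix_vector_mul_assoc)
  have Dt: "transpose ?D = ?D"
    by (auto simp: vec_eq_iff diag_indicator_def transpose_def)
  have DA: "?D ** transpose ?A = 0"
    by (rule matrix_eq[THEN iffD2])
       (simp only: matrix_vector_mul_assoc[symmetric],
        simp add: vec_eq_iff Dv, simp add: restrict_columns_def vector_matrix_mult_def)
  have DG: "?D ** ?G = ?D"
    by (simp add: matrix_add_ldistrib matrix_mul_assoc DA DD)
  have "u = 0" if u: "?G *v u = 0" for u
  proof -
    have Du: "?D *v u = 0"
      using arg_cong[OF u, of "\<lambda>v. ?D *v v"] by (simp add: matrix_vector_mul_assoc DG)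
    have s: "supp u \<subseteq> I"
    proof
      fix i assume "i \<in> supp u"
      show "i \<in> I"
      proof (rule ccontr)
        assume "i \<notin> I"
        hence "(?D *v u) $ i = u $ i"
          by (simp add: Dv)
        thus False using Du \<open>i \<in> supp u\<close> by (simp add: supp_def)
      qed
    qed
    have "transpose ?A *v (?A *v u) = 0"
      using u Du by (simp add: matrix_vector_mult_add_rdistrib matrix_vector_mul_assoc)
    hence "(?A *v u) \<bullet> (?A *v u) = 0"
      by (metis dot_lmul_matrix inner_zero_left vector_transpose_matrix inner_commute transpose_matrix_vector)
    hence "?A *v u = 0" by simp
    moreover have "?A *v u = \<Phi> *v u"
      using s by (auto simp: vec_eq_iff matrix_vector_mult_def restrict_columns_def supp_def intro!: sum.cong)
    ultimately show "u = 0" using inj s by simp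
  qed
  hence inv: "invertible ?G"
    by (simp add: invertible_left_inverse matrix_left_invertible_ker)
  hence RI: "?G ** matrix_inv ?G = mat 1"
    unfolding invertible_def matrix_inv_def by (rule someI2_ex) simp
  hence GP: "?G ** pinv_columns \<Phi> I = transpose ?A"
    by (simp add: pinv_columns_def matrix_mul_assoc RI)
  show 1: "?D ** pinv_columns \<Phi> I = 0"
    by (metis DG DA GP matrix_mul_assoc)
  show "(transpose ?A ** ?A) ** pinv_columns \<Phi> I = transpose ?A"
  proof -
    have "?G ** pinv_columns \<Phi> I
        = (transpose ?A ** ?A) ** pinv_columns \<Phi> I + ?D ** pinv_columns \<Phi> I"
      by (simp add: vec_eq_iff matrix_matrix_mult_def distrib_right sum.distrib)
    thus ?thesis using GP 1 by simp
  qed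
qed

text \<open>
  The iterated supremum is taken over all pairs \<open>(I, l)\<close> at once: for \<open>k \<ge> CARD('m)\<close> the inner
  supremum of the iterated form would be over the empty set when \<open>I = UNIV\<close>.

  \<open>lambda_fac \<Phi> k j\<close> can be negative (the columns need not be normalized). It enters only
  through its square, which gives the bound
  $\|\Phi \delta\|^2 \ge \sigma_{\min,k}^2 \lambda^2(k;j) \|\delta_K\|^2$ (\<open>K\<close> the \<open>k\<close> largest
  of at most \<open>k + j\<close> nonzero entries of \<open>\<delta>\<close>) only for nonnegative values.
\<close>

definition lambda_fac :: "real ^ 'm ^ 'n \<Rightarrow> nat \<Rightarrow> int \<Rightarrow> real" where
  "lambda_fac \<Phi> k j =
     1 - of_int j / sqrt (real k) *
       Sup {norm (pinv_columns \<Phi> I *v column l \<Phi>) | I l. card I \<le> k \<and> l \<notin> I}"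

definition q_radicand ::
  "real ^ 'm ^ 'n \<Rightarrow> real ^ 'n \<Rightarrow> real \<Rightarrow> nat \<Rightarrow> int \<Rightarrow> real" where
  "q_radicand \<Phi> e lam0 k j =
     (c_top (transpose \<Phi> *v e) k)\<^sup>2 +
     lam0 * ((real k)\<^sup>2 * (real k - of_int j) / (real k + of_int j)\<^sup>2) *
       sigma_min_sq \<Phi> k * (lambda_fac \<Phi> k j)\<^sup>2"

definition q_denominator :: "real ^ 'm ^ 'n \<Rightarrow> nat \<Rightarrow> int \<Rightarrow> real" where
  "q_denominator \<Phi> k j =
     real k / (real k + of_int j) * sigma_min_sq \<Phi> k * (lambda_fac \<Phi> k j)\<^sup>2"

definition q' :: "real ^ 'm ^ 'n \<Rightarrow> real ^ 'n \<Rightarrow> real \<Rightarrow> nat \<Rightarrow> int \<Rightarrow> real" where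
  "q' \<Phi> e lam0 k M =
     Sup {(c_top (transpose \<Phi> *v e) 1 + sqrt (q_radicand \<Phi> e lam0 k j)) / q_denominator \<Phi> k j
          | j. 1 \<le> j \<and> j \<le> M \<and> q_radicand \<Phi> e lam0 k j \<ge> 0}"

end

theory Submission
  imports Defs
begin

text \<open>
  Let \<open>z\<close> be a minimizer of (P0) with support \<open>S\<close>, \<open>j = |S|\<close>, \<open>k = |\<Omega>|\<close>, \<open>\<delta> = z - x\<close> and
  \<open>c = \<Phi>\<^sup>T\<epsilon>\<close>. Comparing objective values gives \<open>\<parallel>\<Phi>\<delta>\<parallel>\<^sup>2 - 2 c\<bullet>\<delta> \<le> \<lambda>\<^sub>0 (k - j)\<close>, where \<open>\<delta>\<close> has at most
  \<open>k + j\<close> nonzero entries. Write \<open>a\<close> and \<open>b\<close> for the entry magnitudes of \<open>\<delta>\<close> and \<open>c\<close> in decreasing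
  order. Projecting onto the columns of the \<open>k\<close> largest entries of \<open>\<delta>\<close> bounds \<open>\<parallel>\<Phi>\<delta>\<parallel>\<^sup>2\<close> below by
  \<open>\<sigma>\<^sup>2 \<lambda>\<^sup>2\<close> times the sum of \<open>a\<^sub>l\<^sup>2\<close> over \<open>l < k\<close>. By rearrangement, \<open>c\<bullet>\<delta>\<close> is at most the sum of
  \<open>a\<^sub>l b\<^sub>l\<close> over \<open>l < k + j\<close>, and by monotonicity that is at most \<open>(k + j)/k\<close> times the sum over \<open>l < k\<close>.
  Completing squares in this inequality bounds \<open>a\<^sub>0\<close> by \<open>q'\<close>. An index \<open>i\<close> in \<open>\<Omega>\<close> but not in \<open>S\<close>
  would give \<open>|x\<^sub>i| = |\<delta>\<^sub>i| \<le> a\<^sub>0 \<le> q'\<close>.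
\<close>

section \<open>Inequalities for decreasing real sequences\<close>

text \<open>Summation by parts: the difference of the two sums combines the nonnegative partial sums
  of \<open>g - f\<close> with the weights \<open>a l - a (Suc l)\<close> and the last value of
  \<open>a\<close>, all nonnegative.\<close>

lemma abel_sum_mono:
  fixes a f g :: "nat \<Rightarrow> real"
  assumes "antimono a" and "\<And>l. a l \<ge> 0"
    and partial: "\<And>n. (\<Sum>l<n. f l) \<le> (\<Sum>l<n. g l)"
  shows "(\<Sum>l<n. f l * a l) \<le> (\<Sum>l<n. g l * a l)"
proof (cases n)
  case (Suc N)
  \<comment> \<open>Keeping the last weight times the whole partial sum makes the induction work:
    passing from \<open>a N\<close> to the smaller \<open>a (Suc N)\<close> only lowers this
    bound.\<close>
  have "a N * (\<Sum>l<Suc N. g l - f l) \<le> (\<Sum>l<Suc N. (g l - f l) * a l)"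
  proof (induction N)
    case (Suc N)
    have "a (Suc N) * (\<Sum>l<Suc N. g l - f l) \<le> a N * (\<Sum>l<Suc N. g l - f l)"
      using partial[of "Suc N"] \<open>antimono a\<close>
      by (intro mult_right_mono) (auto simp: antimono_def sum_subtractf)
    then show ?case
      using Suc.IH by (simp add: algebra_simps)
  qed simp
  moreover have "0 \<le> a N * (\<Sum>l<Suc N. g l - f l)"
    using partial[of "Suc N"] assms(2)[of N] by (simp add: sum_subtractf)
  ultimately have "0 \<le> (\<Sum>l<Suc N. (g l - f l) * a l)"
    by linarith
  then show ?thesis
    by (simp add: Suc left_diff_distrib sum_subtractf)
qed simp

text \<open>Adding the elements of \<open>J\<close> in increasing order, each new \<open>x\<close>
  is at least the number of its predecessors, so \<open>b x\<close> is at most the next initial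
  term.\<close>

lemma sum_antimono_le_initial:
  fixes b :: "nat \<Rightarrow> real"
  assumes "antimono b" and "finite J"
  shows "sum b J \<le> (\<Sum>l<card J. b l)"
  using \<open>finite J\<close>
proof (induction rule: finite_linorder_max_induct)
  case (insert x J)
  have "J \<subseteq> {..<x}"
    using insert by auto
  then have "card J \<le> x"
    using card_mono[of "{..<x}" J] by simp
  then have "b x \<le> b (card J)"
    using \<open>antimono b\<close> by (simp add: antimono_def)
  moreover have "x \<notin> J"
    using insert by auto
  ultimately show ?case
    using insert by simp
qed simp

text \<open>The value \<open>f k\<close> separates the first \<open>k\<close> terms from the
  following \<open>j\<close>. This is the source of the factor \<open>k / (k + j)\<close> in
  \<open>q_denominator\<close>.\<close>

lemma sum_antimono_average:
  fixes f :: "nat \<Rightarrow> real"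
  assumes "antimono f"
  shows "real k * (\<Sum>l<k + j. f l) \<le> real (k + j) * (\<Sum>l<k. f l)"
proof -
  have "(\<Sum>l\<in>{k..<k + j}. f l) \<le> real j * f k"
    using sum_bounded_above[of "{k..<k + j}" f "f k"] assms by (simp add: antimono_def)
  moreover have "real k * f k \<le> (\<Sum>l<k. f l)"
    using sum_bounded_below[of "{..<k}" "f k" f] assms by (simp add: antimono_def)
  ultimately have "real k * (\<Sum>l\<in>{k..<k + j}. f l) \<le> real j * (\<Sum>l<k. f l)"
    by (smt (verit) mult.left_commute mult_left_mono of_nat_0_le_iff)
  moreover have "(\<Sum>l<k + j. f l) = (\<Sum>l<k. f l) + (\<Sum>l\<in>{k..<k + j}. f l)"
    by (simp add: lessThan_atLeast0 sum.atLeastLessThan_concat)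
  ultimately show ?thesis
    by (simp add: algebra_simps)
qed

section \<open>Decreasing enumeration of entry magnitudes and rearrangement\<close>

text \<open>Padding by zero keeps the sequence nonnegative and decreasing on all naturals, so sums
  may run up to \<open>k + j\<close> even beyond the dimension.\<close>

definition sorted_mag :: "real ^ 'm \<Rightarrow> nat \<Rightarrow> real" where
  "sorted_mag v l = (if l < CARD('m) then magnitudes v ! l else 0)"

text \<open>\<open>magnitudes\<close> sorts a multiset and so forgets positions. Sorting the indices
  by magnitude instead yields the same list together with an enumeration \<open>p\<close> of the
  indices.\<close>

lemma magnitudes_enumeration:
  fixes v :: "real ^ 'm"
  obtains p where "bij_betw p {..<CARD('m)} UNIV"
    and "\<And>l. l < CARD('m) \<Longrightarrow> sorted_mag v l = \<bar>v $ p l\<bar>"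
    and "magnitudes v = map (sorted_mag v) [0..<CARD('m)]"
proof -
  let ?f = "\<lambda>i. \<bar>v $ i\<bar>"
  obtain ys :: "'m list" where ys: "set ys = UNIV" "distinct ys"
    using finite_distinct_list[of "UNIV :: 'm set"] by auto
  define xs where "xs = rev (sort_key ?f ys)"
  have xs: "set xs = UNIV" "distinct xs"
    using ys by (auto simp: xs_def)
  then have len: "length xs = CARD('m)"
    using distinct_card[of xs] by simp
  have "mset_set UNIV = mset ys"
    using ys mset_set_set[of ys] by simp
  then have "magnitudes v = rev (sort (map ?f ys))"
    unfolding magnitudes_def by (simp flip: mset_map)
  also have "sort (map ?f ys) = map ?f (sort_key ?f ys)"
    by (rule properties_for_sort) auto
  finally have mag: "magnitudes v = map ?f xs"
    by (simp add: xs_def rev_map)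
  show thesis
  proof
    show "bij_betw (\<lambda>l. xs ! l) {..<CARD('m)} UNIV"
      using xs len bij_betw_nth[of xs "{..<CARD('m)}" UNIV] by simp
    show "sorted_mag v l = \<bar>v $ (xs ! l)\<bar>" if "l < CARD('m)" for l
      using that len by (simp add: sorted_mag_def mag)
    show "magnitudes v = map (sorted_mag v) [0..<CARD('m)]"
      by (rule nth_equalityI) (simp_all add: mag len sorted_mag_def)
  qed
qed

lemma sorted_mag_nonneg: "sorted_mag v l \<ge> 0"
  for v :: "real ^ 'm"
  using magnitudes_enumeration[of v]
  by (metis abs_ge_zero sorted_mag_def order_refl)

lemma antimono_sorted_mag: "antimono (sorted_mag v)"
  for v :: "real ^ 'm"
proof (rule antimonoI)
  fix l l' :: nat
  assume le: "l \<le> l'"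
  have len: "length (magnitudes v) = CARD('m)"
    using magnitudes_enumeration[of v] by (metis length_map length_upt diff_zero)
  have "sorted (rev (magnitudes v))"
    by (simp add: magnitudes_def)
  then have "sorted_wrt (\<ge>) (magnitudes v)"
    by (simp add: sorted_wrt_rev)
  then have "magnitudes v ! l' \<le> magnitudes v ! l" if "l' < CARD('m)"
    using le that len by (cases "l = l'") (auto simp: sorted_wrt_iff_nth_less)
  then show "sorted_mag v l' \<le> sorted_mag v l"
    using le sorted_mag_nonneg[of v l] by (auto simp: sorted_mag_def)
qed

lemma c_top_conv_sorted_mag: "(c_top v k)\<^sup>2 = (\<Sum>l<k. (sorted_mag v l)\<^sup>2)"
  for v :: "real ^ 'm"
proof -
  obtain p where mag: "magnitudes v = map (sorted_mag v) [0..<CARD('m)]"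
    using magnitudes_enumeration[of v] by metis
  have "take k [0..<CARD('m)] = [0..<min k CARD('m)]"
    by (cases "k \<le> CARD('m)") simp_all
  then have "(\<Sum>a\<leftarrow>take k (magnitudes v). a\<^sup>2) = (\<Sum>l<min k CARD('m). (sorted_mag v l)\<^sup>2)"
    by (simp add: mag take_map o_def interv_sum_list_conv_sum_set_nat
        lessThan_atLeast0 del: upt_Suc)
  also have "\<dots> = (\<Sum>l<k. (sorted_mag v l)\<^sup>2)"
    by (rule sum.mono_neutral_left) (auto simp: sorted_mag_def)
  finally show ?thesis
    by (simp add: c_top_def sum_nonneg)
qed

lemma c_top_1: "c_top v 1 = sorted_mag v 0"
  for v :: "real ^ 'm"
proof -
  have "c_top v 1 \<ge> 0"
    by (auto simp: c_top_def intro!: sum_list_nonneg)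
  then show ?thesis
    using c_top_conv_sorted_mag[of v 1] sorted_mag_nonneg[of v 0] by (simp add: power2_eq_iff_nonneg)
qed

lemma abs_nth_le_sorted_mag_0: "\<bar>v $ i\<bar> \<le> sorted_mag v 0"
  for v :: "real ^ 'm"
proof -
  obtain p where p: "bij_betw p {..<CARD('m)} UNIV"
    and mag: "\<And>l. l < CARD('m) \<Longrightarrow> sorted_mag v l = \<bar>v $ p l\<bar>"
    using magnitudes_enumeration[of v] by metis
  obtain l where "l < CARD('m)" "p l = i"
    using p by (metis UNIV_I bij_betw_imp_surj_on imageE lessThan_iff)
  then show ?thesis
    using mag[of l] antimono_sorted_mag[of v] by (metis antimonoD le0)
qed

text \<open>A nonzero value at rank \<open>l\<close> forces nonzero entries at all ranks
  \<open>0..l\<close>, which are \<open>Suc l\<close> elements of the support.\<close>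

lemma sorted_mag_eq_0:
  fixes v :: "real ^ 'm"
  assumes "card (supp v) \<le> l"
  shows "sorted_mag v l = 0"
proof (rule ccontr)
  assume nz: "sorted_mag v l \<noteq> 0"
  obtain p where p: "bij_betw p {..<CARD('m)} UNIV"
    and mag: "\<And>l. l < CARD('m) \<Longrightarrow> sorted_mag v l = \<bar>v $ p l\<bar>"
    using magnitudes_enumeration[of v] by metis
  have l: "l < CARD('m)"
    using nz by (auto simp: sorted_mag_def split: if_splits)
  have "p ` {..l} \<subseteq> supp v"
  proof
    fix i assume "i \<in> p ` {..l}"
    then obtain n where n: "n \<le> l" "i = p n" by auto
    then have "sorted_mag v l \<le> sorted_mag v n"
      using antimono_sorted_mag[of v] by (simp add: antimono_def)
    then show "i \<in> supp v"
      using n l mag[of n] nz sorted_mag_nonneg[of v l] by (auto simp: supp_def)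
  qed
  moreover have "inj_on p {..l}"
    using p l by (auto simp: bij_betw_def intro: inj_on_subset)
  ultimately have "Suc l \<le> card (supp v)"
    by (metis card_atMost card_image card_mono finite)
  then show False
    using assms by simp
qed

text \<open>Rearrangement inequality: listed in the order of decreasing \<open>w\<close>-magnitudes,
  the magnitudes of \<open>v\<close> have partial sums dominated by those of
  \<open>sorted_mag v\<close>, so summation by parts applies.\<close>

lemma inner_le_sorted_mag:
  fixes v w :: "real ^ 'm"
  assumes "card (supp w) \<le> N"
  shows "v \<bullet> w \<le> (\<Sum>l<N. sorted_mag v l * sorted_mag w l)"
proof -
  let ?m = "CARD('m)"
  obtain p where p: "bij_betw p {..<?m} UNIV"
    and pm: "\<And>l. l < ?m \<Longrightarrow> sorted_mag w l = \<bar>w $ p l\<bar>"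
    using magnitudes_enumeration[of w] by metis
  obtain r where r: "bij_betw r {..<?m} UNIV"
    and rm: "\<And>l. l < ?m \<Longrightarrow> sorted_mag v l = \<bar>v $ r l\<bar>"
    using magnitudes_enumeration[of v] by metis
  define C where "C l = (if l < ?m then \<bar>v $ p l\<bar> else 0)" for l
  have partial: "(\<Sum>l<n. C l) \<le> (\<Sum>l<n. sorted_mag v l)" for n
  proof -
    \<comment> \<open>\<open>T\<close> holds the indices of the leading entries of \<open>w\<close>;
      \<open>J\<close> holds the ranks of these same indices in the ordering of
      \<open>v\<close>.\<close>
    define T where "T = p ` {..<min n ?m}"
    define J where "J = {..<?m} \<inter> r -` T"
    have injp: "inj_on p {..<min n ?m}"
      using p by (auto simp: bij_betw_def intro: inj_on_subset)
    have injr: "inj_on r J"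
      using r by (auto simp: bij_betw_def J_def intro: inj_on_subset)
    have "r ` J = r ` {..<?m} \<inter> T"
      by (auto simp: J_def)
    then have rJ: "r ` J = T"
      using bij_betw_imp_surj_on[OF r] by simp
    have "card J = min n ?m"
      using card_image[OF injp] card_image[OF injr] rJ by (simp add: T_def)
    have "(\<Sum>l<n. C l) = (\<Sum>l<min n ?m. \<bar>v $ p l\<bar>)"
      by (rule sum.mono_neutral_cong_right) (auto simp: C_def)
    also have "\<dots> = (\<Sum>i\<in>T. \<bar>v $ i\<bar>)"
      by (simp add: T_def sum.reindex[OF injp])
    also have "\<dots> = (\<Sum>l\<in>J. \<bar>v $ r l\<bar>)"
      by (simp add: rJ[symmetric] sum.reindex[OF injr])
    also have "\<dots> = sum (sorted_mag v) J"
      by (rule sum.cong) (auto simp: J_def rm)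
    also have "\<dots> \<le> (\<Sum>l<min n ?m. sorted_mag v l)"
      using sum_antimono_le_initial[OF antimono_sorted_mag, of J v] \<open>card J = _\<close>
      by (simp add: J_def)
    also have "\<dots> = (\<Sum>l<n. sorted_mag v l)"
      by (rule sum.mono_neutral_left) (auto simp: sorted_mag_def)
    finally show ?thesis .
  qed
  have "v \<bullet> w = (\<Sum>l<?m. v $ p l * w $ p l)"
    using sum.reindex_bij_betw[OF p, of "\<lambda>i. v $ i * w $ i"] by (simp add: inner_vec_def)
  also have "\<dots> \<le> (\<Sum>l<?m. C l * sorted_mag w l)"
    by (intro sum_mono) (simp add: C_def pm abs_mult[symmetric])
  also have "\<dots> \<le> (\<Sum>l<?m. sorted_mag v l * sorted_mag w l)"
    using abel_sum_mono[OF antimono_sorted_mag sorted_mag_nonneg partial] .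
  also have "\<dots> = (\<Sum>l<min N ?m. sorted_mag v l * sorted_mag w l)"
    using assms sorted_mag_eq_0[of w]
    by (intro sum.mono_neutral_right) (auto simp: not_less)
  also have "\<dots> = (\<Sum>l<N. sorted_mag v l * sorted_mag w l)"
    by (rule sum.mono_neutral_left) (auto simp: sorted_mag_def)
  finally show ?thesis .
qed

section \<open>Lower bounds for the norm of \<open>\<Phi> *v d\<close>\<close>

lemma sigma_min_sq_bdd_below:
  "bdd_below {(norm (\<Phi> *v d))\<^sup>2 / (norm d)\<^sup>2 | d. d \<noteq> 0 \<and> l0norm d \<le> k}"
  by (rule bdd_belowI[of _ 0]) auto

lemma sigma_min_sq_le:
  assumes "l0norm d \<le> k"
  shows "sigma_min_sq \<Phi> k * (norm d)\<^sup>2 \<le> (norm (\<Phi> *v d))\<^sup>2"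
proof (cases "d = 0")
  case False
  have "sigma_min_sq \<Phi> k \<le> (norm (\<Phi> *v d))\<^sup>2 / (norm d)\<^sup>2"
    unfolding sigma_min_sq_def using False assms
    by (intro cInf_lower sigma_min_sq_bdd_below) auto
  then show ?thesis
    using False by (simp add: field_simps)
qed simp

text \<open>Since \<open>k \<ge> 1\<close>, a unit vector is admissible and the infimum is over a
  nonempty set of nonnegative numbers.\<close>

lemma sigma_min_sq_nonneg:
  fixes \<Phi> :: "real ^ 'm ^ 'n"
  assumes "k \<ge> 1"
  shows "sigma_min_sq \<Phi> k \<ge> 0"
proof -
  have "supp (axis i 1 :: real ^ 'm) = {i}" for i
    by (auto simp: supp_def axis_def)
  then have "\<exists>d :: real ^ 'm. d \<noteq> 0 \<and> l0norm d \<le> k"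
    using assms by (intro exI[of _ "axis undefined 1"]) (simp add: l0norm_def axis_eq_0_iff)
  then have "{(norm (\<Phi> *v d))\<^sup>2 / (norm d)\<^sup>2 | d. d \<noteq> 0 \<and> l0norm d \<le> k} \<noteq> {}"
    by blast
  then show ?thesis
    unfolding sigma_min_sq_def by (rule cInf_greatest) auto
qed

lemma norm_pinv_column_le:
  fixes \<Phi> :: "real ^ 'm ^ 'n"
  assumes "card I \<le> k" "l \<notin> I"
  shows "norm (pinv_columns \<Phi> I *v column l \<Phi>) \<le>
    Sup {norm (pinv_columns \<Phi> I *v column l \<Phi>) | I l. card I \<le> k \<and> l \<notin> I}"
proof (rule cSup_upper)
  let ?X = "{norm (pinv_columns \<Phi> I *v column l \<Phi>) | I l. card I \<le> k \<and> l \<notin> I}"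
  have "?X \<subseteq> (\<lambda>(I, l). norm (pinv_columns \<Phi> I *v column l \<Phi>)) ` UNIV"
    by (auto simp: image_iff)
  then have "finite ?X"
    by (rule finite_subset) simp
  then show "bdd_above ?X"
    by (rule bdd_above_finite)
qed (use assms in auto)

text \<open>With \<open>d = dK + dR\<close>, the vector \<open>\<Phi> *v u\<close> is the projection
  of \<open>\<Phi> *v dR\<close> onto the columns in \<open>K\<close>. Dropping the orthogonal
  residual \<open>r\<close> leaves \<open>dK + u\<close>, supported in \<open>K\<close>, to which
  \<open>sigma_min_sq\<close> applies; \<open>u\<close> is small because \<open>dR\<close> has at
  most \<open>j\<close> nonzero entries, none larger than those in \<open>K\<close>.\<close>

lemma sigma_lambda_le_norm:
  fixes \<Phi> :: "real ^ 'm ^ 'n" and d :: "real ^ 'm"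
  assumes k: "k \<ge> 1" and K: "card K = k"
    and R: "card (supp d - K) \<le> j"
    and top: "\<And>i l. i \<in> K \<Longrightarrow> l \<notin> K \<Longrightarrow> \<bar>d $ l\<bar> \<le> \<bar>d $ i\<bar>"
    and sig: "sigma_min_sq \<Phi> k > 0"
    and lam: "lambda_fac \<Phi> k (int j) \<ge> 0"
  shows "sigma_min_sq \<Phi> k * (lambda_fac \<Phi> k (int j))\<^sup>2 * (\<Sum>i\<in>K. (d $ i)\<^sup>2)
    \<le> (norm (\<Phi> *v d))\<^sup>2"
proof -
  define dK :: "real ^ 'm" where "dK = (\<chi> i. if i \<in> K then d $ i else 0)"
  define dR where "dR = d - dK"
  let ?P = "pinv_columns \<Phi> K" and ?A = "restrict_columns \<Phi> K"
  define u where "u = ?P *v (\<Phi> *v dR)"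
  define r where "r = \<Phi> *v dR - \<Phi> *v u"
  have A: "?A *v w = \<Phi> *v w" if "supp w \<subseteq> K" for w
    using that
    by (auto simp: vec_eq_iff matrix_vector_mult_def restrict_columns_def supp_def intro!: sum.cong)
  have l0: "l0norm w \<le> k" if "supp w \<subseteq> K" for w :: "real ^ 'm"
    using that K by (metis l0norm_def card_mono finite)
  \<comment> \<open>Positivity of \<open>sigma_min_sq\<close> makes the columns in \<open>K\<close>
    linearly independent, as \<open>pinv_columns_correct\<close> requires.\<close>
  have inj: "w = 0" if "supp w \<subseteq> K" "\<Phi> *v w = 0" for w
  proof -
    have "sigma_min_sq \<Phi> k * (norm w)\<^sup>2 \<le> 0"
      using sigma_min_sq_le[OF l0[OF that(1)], of \<Phi>] that(2) by simp
    then show ?thesis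
      using sig by (simp add: mult_le_0_iff)
  qed
  have supp_u: "supp u \<subseteq> K"
  proof
    fix i assume i: "i \<in> supp u"
    have "diag_indicator (- K) *v u = 0"
      using pinv_columns_correct(1)[of K \<Phi>, OF inj] by (simp add: u_def matrix_vector_mul_assoc matrix_mul_assoc)
    moreover have "(diag_indicator (- K) *v u) $ i = (\<Sum>a\<in>UNIV. if i = a then (if i \<in> K then 0 else u $ a) else 0)"
      unfolding matrix_vector_mult_def diag_indicator_def vec_lambda_beta
      by (rule sum.cong) auto
    ultimately show "i \<in> K"
      using i by (auto simp: supp_def split: if_splits)
  qed
  have supp_K: "supp dK \<subseteq> K"
    by (auto simp: dK_def supp_def)
  have "supp (dK + u) \<subseteq> supp dK \<union> supp u"
    by (auto simp: supp_def)
  then have supp_w: "supp (dK + u) \<subseteq> K"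
    using supp_u supp_K by blast
  \<comment> \<open>These are the normal equations; they make \<open>r\<close> orthogonal to every
    column in \<open>K\<close>.\<close>
  have "transpose ?A *v (?A *v (?P *v v)) = transpose ?A *v v" for v
    by (simp only: matrix_vector_mul_assoc matrix_mul_assoc pinv_columns_correct(2)[of K \<Phi>, OF inj])
  then have "transpose ?A *v r = 0"
    by (simp only: r_def A[OF supp_u, symmetric] matrix_vector_mult_diff_distrib)
       (simp add: u_def)
  moreover have "r \<bullet> (?A *v (dK + u)) = (transpose ?A *v r) \<bullet> (dK + u)"
    by (simp add: dot_lmul_matrix)
  ultimately have orth: "(\<Phi> *v (dK + u)) \<bullet> r = 0"
    by (simp add: A[OF supp_w] inner_commute)
  have "\<Phi> *v d = \<Phi> *v (dK + u) + r"
    by (simp add: r_def dR_def matrix_vector_right_distrib matrix_vector_mult_diff_distrib)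
  then have "(norm (\<Phi> *v d))\<^sup>2 = (norm (\<Phi> *v (dK + u)))\<^sup>2 + (norm r)\<^sup>2"
    using orth by (simp add: norm_add_Pythagorean orthogonal_def)
  then have w: "sigma_min_sq \<Phi> k * (norm (dK + u))\<^sup>2 \<le> (norm (\<Phi> *v d))\<^sup>2"
    using sigma_min_sq_le[OF l0[OF supp_w], of \<Phi>] by (smt (verit) zero_le_power2)
  have norm_dK: "(norm dK)\<^sup>2 = (\<Sum>i\<in>K. (d $ i)\<^sup>2)"
  proof -
    have "(norm dK)\<^sup>2 = (\<Sum>i\<in>UNIV. (dK $ i)\<^sup>2)"
      by (simp add: norm_vec_def L2_set_def sum_nonneg)
    also have "\<dots> = (\<Sum>i\<in>K. (d $ i)\<^sup>2)"
      by (rule sum.mono_neutral_cong_right) (auto simp: dK_def)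
    finally show ?thesis .
  qed
  define \<mu> where "\<mu> = Sup {norm (pinv_columns \<Phi> I *v column l \<Phi>) | I l. card I \<le> k \<and> l \<notin> I}"
  have mu: "norm (?P *v column l \<Phi>) \<le> \<mu>" if "l \<notin> K" for l
    unfolding \<mu>_def using K that by (intro norm_pinv_column_le) auto
  \<comment> \<open>An entry outside \<open>K\<close> is bounded by each of the \<open>k\<close>
    entries in \<open>K\<close>, hence by their root mean square.\<close>
  have small: "\<bar>d $ l\<bar> \<le> norm dK / sqrt k" if "l \<notin> K" for l
  proof -
    have "real k * \<bar>d $ l\<bar>\<^sup>2 \<le> (\<Sum>i\<in>K. (d $ i)\<^sup>2)"
      using sum_bounded_below[of K "\<bar>d $ l\<bar>\<^sup>2" "\<lambda>i. (d $ i)\<^sup>2"] top that K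
      by (simp add: abs_le_square_iff)
    then have "(sqrt k * \<bar>d $ l\<bar>)\<^sup>2 \<le> (norm dK)\<^sup>2"
      by (simp add: norm_dK power_mult_distrib)
    then have "sqrt k * \<bar>d $ l\<bar> \<le> norm dK"
      by (rule power2_le_imp_le) simp
    then show ?thesis
      using k by (simp add: field_simps)
  qed
  have "norm u \<le> real j * \<mu> * (norm dK / sqrt k)"
  proof -
    have "u = (\<Sum>l\<in>UNIV. dR $ l *s (?P *v column l \<Phi>))"
      unfolding u_def
      by (simp add: matrix_mult_sum[of \<Phi>] linear_sum[OF matrix_vector_mul_linear]
          matrix_vector_mult_scaleR scalar_mult_eq_scaleR)
    also have "\<dots> = (\<Sum>l\<in>supp d - K. d $ l *s (?P *v column l \<Phi>))"
      by (rule sum.mono_neutral_cong_right) (auto simp: dR_def dK_def supp_def)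
    finally have "norm u \<le> (\<Sum>l\<in>supp d - K. \<bar>d $ l\<bar> * norm (?P *v column l \<Phi>))"
      by (simp add: sum_norm_le scalar_mult_eq_scaleR)
    also have "\<dots> \<le> (\<Sum>l\<in>supp d - K. norm dK / sqrt k * \<mu>)"
      by (intro sum_mono mult_mono small mu) auto
    also have "\<dots> = real (card (supp d - K)) * (norm dK / sqrt k * \<mu>)"
      by simp
    also have "\<dots> \<le> real j * (norm dK / sqrt k * \<mu>)"
    proof -
      \<comment> \<open>The empty index set with an arbitrary column gives a nonnegative member of
        the set, hence \<open>\<mu> \<ge> 0\<close>.\<close>
      have "norm (pinv_columns \<Phi> {} *v column undefined \<Phi>) \<le> \<mu>"
        unfolding \<mu>_def by (intro norm_pinv_column_le) auto
      then have "\<mu> \<ge> 0"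
        using norm_ge_zero order_trans by blast
      then show ?thesis
        using R by (intro mult_right_mono) auto
    qed
    finally show ?thesis
      by (simp add: mult_ac)
  qed
  moreover have "lambda_fac \<Phi> k (int j) * norm dK = norm dK - real j * \<mu> * (norm dK / sqrt k)"
    by (simp add: lambda_fac_def \<mu>_def[symmetric] algebra_simps)
  ultimately have "lambda_fac \<Phi> k (int j) * norm dK \<le> norm (dK + u)"
    by (smt (verit) norm_diff_ineq)
  \<comment> \<open>Squaring preserves the inequality because \<open>lambda_fac\<close> is
    nonnegative here.\<close>
  then have "(lambda_fac \<Phi> k (int j) * norm dK)\<^sup>2 \<le> (norm (dK + u))\<^sup>2"
    using lam by (intro power_mono) auto
  then have "sigma_min_sq \<Phi> k * (lambda_fac \<Phi> k (int j) * norm dK)\<^sup>2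
      \<le> sigma_min_sq \<Phi> k * (norm (dK + u))\<^sup>2"
    using sig by (intro mult_left_mono) auto
  then show ?thesis
    using w by (simp add: norm_dK[symmetric] power_mult_distrib mult.assoc)
qed

text \<open>Take \<open>K\<close> to be the first \<open>k\<close> indices of a decreasing
  enumeration; the rest of the support has ranks in \<open>{k..<k + j}\<close>.\<close>

lemma sigma_lambda_sorted_mag_le_norm:
  fixes \<Phi> :: "real ^ 'm ^ 'n" and d :: "real ^ 'm"
  assumes k: "k \<ge> 1" "k \<le> CARD('m)"
    and supp: "card (supp d) \<le> k + j"
    and sig: "sigma_min_sq \<Phi> k > 0"
    and lam: "lambda_fac \<Phi> k (int j) \<ge> 0"
  shows "sigma_min_sq \<Phi> k * (lambda_fac \<Phi> k (int j))\<^sup>2 * (\<Sum>l<k. (sorted_mag d l)\<^sup>2)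
    \<le> (norm (\<Phi> *v d))\<^sup>2"
proof -
  obtain p where p: "bij_betw p {..<CARD('m)} UNIV"
    and mag: "\<And>l. l < CARD('m) \<Longrightarrow> sorted_mag d l = \<bar>d $ p l\<bar>"
    using magnitudes_enumeration[of d] by metis
  have inj: "inj_on p {..<CARD('m)}"
    using p by (simp add: bij_betw_def)
  then have injk: "inj_on p {..<k}"
    using k by (auto intro: inj_on_subset)
  define K where "K = p ` {..<k}"
  have surj: "\<exists>l<CARD('m). p l = i" for i
    using p by (metis UNIV_I bij_betw_imp_surj_on imageE lessThan_iff)
  have "supp d - K \<subseteq> p ` {k..<k + j}"
  proof
    fix i assume i: "i \<in> supp d - K"
    obtain l where l: "l < CARD('m)" "p l = i"
      using surj by blast
    have "\<not> l < k"
      using i l by (auto simp: K_def)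
    moreover have "\<not> k + j \<le> l"
      using i l mag[of l] sorted_mag_eq_0[of d l] supp by (auto simp: supp_def)
    ultimately show "i \<in> p ` {k..<k + j}"
      using l by auto
  qed
  then have "card (supp d - K) \<le> card (p ` {k..<k + j})"
    by (intro card_mono) auto
  also have "\<dots> \<le> j"
    using card_image_le[of "{k..<k + j}" p] by simp
  finally have R: "card (supp d - K) \<le> j" .
  have top: "\<bar>d $ l\<bar> \<le> \<bar>d $ i\<bar>" if "i \<in> K" "l \<notin> K" for i l
  proof -
    obtain a where a: "a < k" "p a = i"
      using \<open>i \<in> K\<close> by (auto simp: K_def)
    obtain b where b: "b < CARD('m)" "p b = l"
      using surj by blast
    have "a \<le> b"
      using a b \<open>l \<notin> K\<close> by (force simp: K_def)
    then show ?thesis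
      using mag[of a] mag[of b] a b k antimono_sorted_mag[of d] by (auto dest!: antimonoD)
  qed
  have "(\<Sum>i\<in>K. (d $ i)\<^sup>2) = (\<Sum>l<k. (sorted_mag d l)\<^sup>2)"
    using k by (simp add: K_def sum.reindex[OF injk] mag)
  moreover have "card K = k"
    by (simp add: K_def card_image[OF injk])
  ultimately show ?thesis
    using sigma_lambda_le_norm[OF k(1) _ R top sig lam] by simp
qed

section \<open>From the quadratic inequality to the bound by \<open>q'\<close>\<close>

text \<open>Completing the square in each of the \<open>k\<close> largest coordinates separately is what lets
  \<open>c(\<Phi>\<^sup>T\<epsilon>, 1)\<close>, rather than \<open>c(\<Phi>\<^sup>T\<epsilon>, k)\<close>, stand outside the root.\<close>

lemma first_le_of_quadratic_sum:
  fixes a b :: "nat \<Rightarrow> real"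
  assumes "k \<ge> 1" and "A > 0"
    and le: "A * (\<Sum>l<k. (a l)\<^sup>2) - 2 * (\<Sum>l<k. b l * a l) \<le> L"
  shows "0 \<le> (\<Sum>l<k. (b l)\<^sup>2) + A * L"
    and "A * a 0 \<le> b 0 + sqrt ((\<Sum>l<k. (b l)\<^sup>2) + A * L)"
proof -
  have "(\<Sum>l<k. (A * a l - b l)\<^sup>2)
      = A * (A * (\<Sum>l<k. (a l)\<^sup>2) - 2 * (\<Sum>l<k. b l * a l)) + (\<Sum>l<k. (b l)\<^sup>2)"
    by (simp add: power2_diff power_mult_distrib sum.distrib sum_subtractf sum_distrib_left
        right_diff_distrib power2_eq_square mult_ac)
  also have "\<dots> \<le> A * L + (\<Sum>l<k. (b l)\<^sup>2)"
    using le \<open>A > 0\<close> by simp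
  finally have sq: "(\<Sum>l<k. (A * a l - b l)\<^sup>2) \<le> (\<Sum>l<k. (b l)\<^sup>2) + A * L"
    by simp
  \<comment> \<open>Only the coordinate of rank \<open>0\<close> is kept; the other squares are
    dropped.\<close>
  moreover have "(A * a 0 - b 0)\<^sup>2 \<le> (\<Sum>l<k. (A * a l - b l)\<^sup>2)"
    using \<open>k \<ge> 1\<close> by (intro member_le_sum) auto
  ultimately have first: "(A * a 0 - b 0)\<^sup>2 \<le> (\<Sum>l<k. (b l)\<^sup>2) + A * L"
    by linarith
  then show "0 \<le> (\<Sum>l<k. (b l)\<^sup>2) + A * L"
    by (smt (verit) zero_le_power2)
  have "A * a 0 - b 0 \<le> sqrt ((\<Sum>l<k. (b l)\<^sup>2) + A * L)"
    using first by (rule real_le_rsqrt)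
  then show "A * a 0 \<le> b 0 + sqrt ((\<Sum>l<k. (b l)\<^sup>2) + A * L)"
    by simp
qed

text \<open>The integers \<open>j\<close> in \<open>{1..M}\<close> give finitely many values, so the
  supremum is a genuine upper bound.\<close>

lemma q'_upper:
  assumes "1 \<le> j" "j \<le> M" "q_radicand \<Phi> e lam0 k j \<ge> 0"
  shows "(c_top (transpose \<Phi> *v e) 1 + sqrt (q_radicand \<Phi> e lam0 k j)) / q_denominator \<Phi> k j
    \<le> q' \<Phi> e lam0 k M"
  unfolding q'_def
proof (rule cSup_upper)
  let ?g = "\<lambda>j. (c_top (transpose \<Phi> *v e) 1 + sqrt (q_radicand \<Phi> e lam0 k j)) / q_denominator \<Phi> k j"
  let ?X = "{?g j | j. 1 \<le> j \<and> j \<le> M \<and> q_radicand \<Phi> e lam0 k j \<ge> 0}"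
  have "?X \<subseteq> ?g ` {1..M}"
    by auto
  then have "finite ?X"
    by (rule finite_subset) simp
  then show "bdd_above ?X"
    by (rule bdd_above_finite)
qed (use assms in auto)

theorem theorem3p2:
  fixes \<Phi> :: "real ^ 'm ^ 'n" and y eps :: "real ^ 'n" and x :: "real ^ 'm"
    and lam0 :: real and \<Omega> S :: "'m set" and M :: int
  assumes "CARD('n) > CARD('m)"
    and "lam0 \<ge> 0"
    and "\<Omega> \<noteq> {}"
    and "is_arg_min (\<lambda>z. (norm (y - \<Phi> *v z))\<^sup>2) (\<lambda>z. supp z \<subseteq> \<Omega>) x"
    and "eps = y - \<Phi> *v x"
    and "\<And>j. 1 \<le> j \<Longrightarrow> j \<le> M \<Longrightarrow> q_denominator \<Phi> (card \<Omega>) j \<noteq> 0"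
    and "type0_optimal \<Phi> y lam0 S"
    and "1 \<le> int (card S)" and "int (card S) \<le> M"
    and "lambda_fac \<Phi> (card \<Omega>) (int (card S)) \<ge> 0"
    and "Min ((\<lambda>i. \<bar>x $ i\<bar>) ` \<Omega>) > q' \<Phi> eps lam0 (card \<Omega>) M"
  shows "\<Omega> \<subseteq> S"
proof (rule ccontr)
  assume "\<not> \<Omega> \<subseteq> S"
  then obtain i where i: "i \<in> \<Omega>" "i \<notin> S" by blast
  define k where "k = card \<Omega>"
  define j where "j = card S"
  have k: "k \<ge> 1" "k \<le> CARD('m)"
    using \<open>\<Omega> \<noteq> {}\<close> card_gt_0_iff[of \<Omega>] card_mono[of UNIV \<Omega>] by (auto simp: k_def)
  have j: "j \<ge> 1"
    using assms(8) by (simp add: j_def)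
  obtain z where z: "is_arg_min (P0_objective \<Phi> y lam0) (\<lambda>_. True) z" "supp z = S"
    using assms(7) by (auto simp: type0_optimal_def)
  have supp_x: "supp x \<subseteq> \<Omega>"
    using assms(4) by (simp add: is_arg_min_def)
  define d where "d = z - x"
  define c where "c = transpose \<Phi> *v eps"
  define B where "B = sigma_min_sq \<Phi> k * (lambda_fac \<Phi> k (int j))\<^sup>2"
  define A where "A = q_denominator \<Phi> k (int j)"
  have A_eq: "A = real k / real (k + j) * B"
    by (simp add: A_def B_def q_denominator_def)
  \<comment> \<open>Well-definedness of the quotient at \<open>j = card S\<close> excludes
    \<open>sigma_min_sq \<Phi> k = 0\<close>, so both this infimum and \<open>A\<close> are
    positive.\<close>
  have "A \<noteq> 0"
    using assms(6)[of "int j"] assms(8,9) by (simp add: A_def k_def j_def)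
  then have "sigma_min_sq \<Phi> k \<noteq> 0"
    by (auto simp: A_eq B_def)
  then have sig: "sigma_min_sq \<Phi> k > 0"
    using sigma_min_sq_nonneg[OF k(1), of \<Phi>] by simp
  then have "A \<ge> 0"
    by (simp add: A_eq B_def)
  with \<open>A \<noteq> 0\<close> have A: "A > 0"
    by simp
  have "supp d \<subseteq> \<Omega> \<union> S"
    using supp_x z(2) by (auto simp: d_def supp_def)
  then have supp_d: "card (supp d) \<le> k + j"
    using card_mono[of "\<Omega> \<union> S" "supp d"] card_Un_le[of \<Omega> S] by (simp add: k_def j_def)
  have "P0_objective \<Phi> y lam0 z \<le> P0_objective \<Phi> y lam0 x"
    using z(1) by (auto simp: is_arg_min_def not_less)
  moreover have "lam0 * real (l0norm x) \<le> lam0 * real k"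
    using card_mono[OF _ supp_x] \<open>lam0 \<ge> 0\<close> by (simp add: l0norm_def k_def mult_left_mono)
  moreover have "y - \<Phi> *v z = eps - \<Phi> *v d"
    by (simp add: assms(5) d_def matrix_vector_mult_diff_distrib)
  ultimately have "(norm (eps - \<Phi> *v d))\<^sup>2 + lam0 * real j \<le> (norm eps)\<^sup>2 + lam0 * real k"
    using assms(5) z(2) by (simp add: P0_objective_def l0norm_def j_def)
  moreover have "(norm (eps - \<Phi> *v d))\<^sup>2 = (norm eps)\<^sup>2 - 2 * (c \<bullet> d) + (norm (\<Phi> *v d))\<^sup>2"
  proof -
    have "c \<bullet> d = eps \<bullet> (\<Phi> *v d)"
      by (simp add: c_def dot_lmul_matrix)
    then show ?thesis
      by (simp add: power2_norm_eq_inner inner_diff inner_commute)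
  qed
  ultimately have main: "(norm (\<Phi> *v d))\<^sup>2 - 2 * (c \<bullet> d) \<le> lam0 * (real k - real j)"
    by (simp add: algebra_simps)
  let ?a = "sorted_mag d" and ?b = "sorted_mag c"
  have "B * (\<Sum>l<k. (?a l)\<^sup>2) \<le> (norm (\<Phi> *v d))\<^sup>2"
    unfolding B_def
    using sigma_lambda_sorted_mag_le_norm[OF k supp_d sig] assms(10) by (simp add: k_def j_def)
  moreover have "real k * (c \<bullet> d) \<le> real (k + j) * (\<Sum>l<k. ?b l * ?a l)"
  proof -
    have "antimono (\<lambda>l. ?b l * ?a l)"
      using antimono_sorted_mag[of c] antimono_sorted_mag[of d]
      by (auto simp: antimono_def intro!: mult_mono sorted_mag_nonneg)
    from sum_antimono_average[OF this, of k j] show ?thesis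
      using mult_left_mono[OF inner_le_sorted_mag[OF supp_d, of c], of "real k"] by linarith
  qed
  ultimately have "real k * (B * (\<Sum>l<k. (?a l)\<^sup>2)) - 2 * (real (k + j) * (\<Sum>l<k. ?b l * ?a l))
      \<le> real k * (lam0 * (real k - real j))"
    using main mult_left_mono[of "B * (\<Sum>l<k. (?a l)\<^sup>2) - 2 * (c \<bullet> d)" "lam0 * (real k - real j)" "real k"]
    by (simp add: right_diff_distrib)
  \<comment> \<open>By this identity the factor \<open>k + j\<close> from averaging the products
    also appears in the quadratic term and can be divided out.\<close>
  moreover have "real k * B = real (k + j) * A"
    using k by (simp add: A_eq)
  ultimately have "real (k + j) * (A * (\<Sum>l<k. (?a l)\<^sup>2) - 2 * (\<Sum>l<k. ?b l * ?a l))
      \<le> real k * (lam0 * (real k - real j))"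
    by (simp only: mult.assoc[symmetric] right_diff_distrib)
  then have "A * (\<Sum>l<k. (?a l)\<^sup>2) - 2 * (\<Sum>l<k. ?b l * ?a l)
      \<le> lam0 * real k * (real k - real j) / real (k + j)" (is "_ \<le> ?L")
    using k by (simp add: pos_le_divide_eq mult_ac)
  note quad = first_le_of_quadratic_sum[OF k(1) A this]
  \<comment> \<open>The factor \<open>k / (k + j)\<close> in \<open>A\<close> and the one in
    \<open>?L\<close> multiply to the \<open>k\<^sup>2 / (k + j)\<^sup>2\<close> of the
    radicand.\<close>
  have rad: "(\<Sum>l<k. (?b l)\<^sup>2) + A * ?L = q_radicand \<Phi> eps lam0 k (int j)"
    unfolding q_radicand_def c_def[symmetric] c_top_conv_sorted_mag A_eq B_def
    by (simp add: power2_eq_square mult_ac)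
  have "\<bar>x $ i\<bar> = \<bar>d $ i\<bar>"
    using i z(2) by (auto simp: d_def supp_def)
  also have "\<dots> \<le> ?a 0"
    by (rule abs_nth_le_sorted_mag_0)
  also have "\<dots> \<le> (c_top c 1 + sqrt (q_radicand \<Phi> eps lam0 k (int j))) / A"
    using quad(2) A unfolding rad c_top_1 by (simp add: pos_le_divide_eq mult.commute)
  \<comment> \<open>The sum of squares bounded by the radicand shows it nonnegative, so this
    \<open>j\<close> is not discarded from the supremum.\<close>
  also have "\<dots> \<le> q' \<Phi> eps lam0 k M"
    unfolding A_def c_def using quad(1)[unfolded rad] j assms(9) by (intro q'_upper) (simp_all add: j_def)
  also have "\<dots> < Min ((\<lambda>i. \<bar>x $ i\<bar>) ` \<Omega>)"
    using assms(11) by (simp add: k_def)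
  also have "\<dots> \<le> \<bar>x $ i\<bar>"
    using i by (intro Min_le) auto
  finally show False by simp
qed

end
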